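(* Let $G=(\mathcal{V},\mathcal{E})$ be an irreducible (finite, directed) graph, let $X=\mathsf{X}_G$ be its edge shift, and let $Y=\pi(X)$, where $\pi$ is (the 1-block factor code induced by) a labelling map on $\mathcal{E}$. Then the following are equivalent: (1) $\pi$ is right class-closing. (2) Any two points from distinct right classes over the same point of $Y$ are mutually separated. (3) $[x]^l\subset[x]^r$ for all $x\in X$. (Equivalently, every right class is a union of left classes.) (4) There is an integer $D\ge 0$ such that for every vertex $I\in\mathcal{V}$, any set of paths of length $D+1$ in $G$ that start at $I$ and all have the same label is tangled. (5) There is an integer $D\ge 0$ such that for every vertex $I\in\mathcal{V}$, any set of paths of length $D+1$ in $G$ that all have the same label and that is right accessible from $I$ is tangled. Furthermore, any $D$ satisfying the condition in (4) satisfies the condition in (5), and vice versa.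
   Context: $\mathsf{X}_G\subset\mathcal{E}^{\mathbb{Z}}$ is the set of all bi-infinite paths in the finite directed graph $G$ (symbols are edges); $G$ is irreducible if for every ordered pair of vertices $I,J$ there is a path from $I$ to $J$. A labelling map assigns a symbol to each edge; it extends to finite paths (words in $\mathcal{B}(\mathsf{X}_G)$) and to points coordinatewise, and is denoted by $\pi$ throughout. The label of a path $u$ is $\pi(u)$. $\mathcal{B}(\cdot)$ denotes the set of words occurring in points of a shift space, including the empty word. $\mathsf{i}_G$ and $\mathsf{t}_G$ denote the initial and terminal vertex of a path (or the set of these for a set of paths). Two points $x,x'$ are left asymptotic if $x|_{(-\infty,n]}=x'|_{(-\infty,n]}$ for some $n\in\mathbb{Z}$. They are mutually separated if $x|_i\neq x'|_i$ for every $i\in\mathbb{Z}$. Classes. Let $x,x'\in X$ with $\pi(x)=\pi(x')$ and $m\in\mathbb{Z}$. A right $m$-bridge from $x$ to $x'$ is a point $z\in X$ with $\pi(z)=\pi(x)$ such that for some $n>m$, $z|_{(-\infty,m]}=x|_{(-\infty,m]}$ and $z|_{[n,\infty)}=x'|_{[n,\infty)}$. A left $m$-bridge from $x$ to $x'$ is a point $z\in X$ with $\pi(z)=\pi(x)$ such that for some $n<m$, $z|_{(-\infty,n]}=x'|_{(-\infty,n]}$ and $z|_{[m,\infty)}=x|_{[m,\infty)}$. Write $x\to^r x'$ (resp. $x\to^l x'$) if for every $m\in\mathbb{Z}$ there is a right (resp. left) $m$-bridge from $x$ to $x'$. Points $x,x'$ in the same fibre are right equivalent, $x\sim^r x'$,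 if $x\to^r x'$ and $x'\to^r x$; left equivalent, $x\sim^l x'$, if $x\to^l x'$ and $x'\to^l x$. These are equivalence relations on each fibre $\pi^{-1}(y)$; the classes $[x]^r$, $[x]^l$ are the right class and left class of $x$, and are said to be over $y=\pi(x)$. $\pi$ is right class-closing if any two left asymptotic points $x,x'\in X$ with $\pi(x)=\pi(x')$ are right equivalent. Tangled sets. For paths $u,w$ of the same length $l$ with $\pi(u)=\pi(w)$, a bridge from $u$ to $w$ is a path $v$ in $G$ of length $l$ with $v|_1=u|_1$, $v|_l=w|_l$ and $\pi(v)=\pi(u)=\pi(w)$. A 2-way bridge between $u$ and $w$ is a pair consisting of a bridge from $u$ to $w$ and a bridge from $w$ to $u$. A set of paths all having the same label is tangled if between any two of its members there is a 2-way bridge (the bridges themselves need not belong to the set). Accessibility. For $v\in\mathcal{B}(Y)$ and $I\in\mathcal{V}$, let $\mathsf{t}_{G,\{I\}}(v)$ be the set of terminal vertices of paths labelled $v$ starting at $I$; for the empty word this is $\{I\}$. A set of vertices $\mathcal{J}\subset\mathcal{V}$ is right accessible from $I$ via $v$ if $\mathcal{J}\subset\mathsf{t}_{G,\{I\}}(v)$. A set $\Gamma$ of paths with the same label is right accessible from $I$ if there is some $v\in\mathcal{B}(Y)$ such that $\mathsf{i}_G(\Gamma)$ is right accessible from $I$ via $v$. *)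

theory Defs
  imports Graph_Theory.Arc_Walk
begin

section \<open>Graphs and paths\<close>

text \<open>
  A path is a list of arcs that is an arc walk between some two vertices; the empty list is the
  empty path at every vertex. Graphs may have loops and parallel arcs. The label of a path p
  is \<open>map L p\<close>.
\<close>

definition irreducible_graph :: "('v, 'e) pre_digraph \<Rightarrow> bool" where
  "irreducible_graph G \<longleftrightarrow>
     (\<forall>I \<in> verts G. \<forall>J \<in> verts G. \<exists>p. pre_digraph.awalk G I p J)"

definition paths :: "('v, 'e) pre_digraph \<Rightarrow> 'e list set" where
  "paths G = {p. \<exists>I J. pre_digraph.awalk G I p J}"

definition initial_vertices :: "('v, 'e) pre_digraph \<Rightarrow> 'e list set \<Rightarrow> 'v set" where
  "initial_vertices G \<Gamma> = {I. \<exists>p \<in> \<Gamma>. \<exists>J. pre_digraph.awalk G I p J}"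

definition same_label :: "('e \<Rightarrow> 'c) \<Rightarrow> 'e list set \<Rightarrow> bool" where
  "same_label L \<Gamma> \<longleftrightarrow> (\<forall>u \<in> \<Gamma>. \<forall>w \<in> \<Gamma>. map L u = map L w)"


section \<open>Edge shifts and labellings\<close>

definition edge_shift :: "('v, 'e) pre_digraph \<Rightarrow> (int \<Rightarrow> 'e) set" where
  "edge_shift G = {x. \<forall>i. x i \<in> arcs G \<and> head G (x i) = tail G (x (i + 1))}"

definition block_map :: "('e \<Rightarrow> 'c) \<Rightarrow> (int \<Rightarrow> 'e) \<Rightarrow> (int \<Rightarrow> 'c)" where
  "block_map L x = (\<lambda>i. L (x i))"

text \<open>The empty word belongs to the language of every shift space.\<close>

definition language :: "(int \<Rightarrow> 'c) set \<Rightarrow> 'c list set" where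
  "language S = insert [] {map y [i..j] | y i j. y \<in> S}"

definition left_asymptotic :: "(int \<Rightarrow> 'e) \<Rightarrow> (int \<Rightarrow> 'e) \<Rightarrow> bool" where
  "left_asymptotic x x' \<longleftrightarrow> (\<exists>n. \<forall>i \<le> n. x i = x' i)"

definition mutually_separated :: "(int \<Rightarrow> 'e) \<Rightarrow> (int \<Rightarrow> 'e) \<Rightarrow> bool" where
  "mutually_separated x x' \<longleftrightarrow> (\<forall>i. x i \<noteq> x' i)"


section \<open>Right and left classes\<close>

definition right_bridge ::
  "('v, 'e) pre_digraph \<Rightarrow> ('e \<Rightarrow> 'c) \<Rightarrow> int \<Rightarrow> (int \<Rightarrow> 'e) \<Rightarrow> (int \<Rightarrow> 'e) \<Rightarrow> (int \<Rightarrow> 'e) \<Rightarrow> bool" where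
  "right_bridge G L m x x' z \<longleftrightarrow>
     z \<in> edge_shift G \<and> block_map L z = block_map L x \<and>
     (\<exists>n > m. (\<forall>i \<le> m. z i = x i) \<and> (\<forall>i \<ge> n. z i = x' i))"

definition left_bridge ::
  "('v, 'e) pre_digraph \<Rightarrow> ('e \<Rightarrow> 'c) \<Rightarrow> int \<Rightarrow> (int \<Rightarrow> 'e) \<Rightarrow> (int \<Rightarrow> 'e) \<Rightarrow> (int \<Rightarrow> 'e) \<Rightarrow> bool" where
  "left_bridge G L m x x' z \<longleftrightarrow>
     z \<in> edge_shift G \<and> block_map L z = block_map L x \<and>
     (\<exists>n < m. (\<forall>i \<le> n. z i = x' i) \<and> (\<forall>i \<ge> m. z i = x i))"

definition right_trans ::
  "('v, 'e) pre_digraph \<Rightarrow> ('e \<Rightarrow> 'c) \<Rightarrow> (int \<Rightarrow> 'e) \<Rightarrow> (int \<Rightarrow> 'e) \<Rightarrow> bool" where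
  "right_trans G L x x' \<longleftrightarrow> (\<forall>m. \<exists>z. right_bridge G L m x x' z)"

definition left_trans ::
  "('v, 'e) pre_digraph \<Rightarrow> ('e \<Rightarrow> 'c) \<Rightarrow> (int \<Rightarrow> 'e) \<Rightarrow> (int \<Rightarrow> 'e) \<Rightarrow> bool" where
  "left_trans G L x x' \<longleftrightarrow> (\<forall>m. \<exists>z. left_bridge G L m x x' z)"

definition same_fibre ::
  "('v, 'e) pre_digraph \<Rightarrow> ('e \<Rightarrow> 'c) \<Rightarrow> (int \<Rightarrow> 'e) \<Rightarrow> (int \<Rightarrow> 'e) \<Rightarrow> bool" where
  "same_fibre G L x x' \<longleftrightarrow>
     x \<in> edge_shift G \<and> x' \<in> edge_shift G \<and> block_map L x = block_map L x'"

definition right_equivalent ::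
  "('v, 'e) pre_digraph \<Rightarrow> ('e \<Rightarrow> 'c) \<Rightarrow> (int \<Rightarrow> 'e) \<Rightarrow> (int \<Rightarrow> 'e) \<Rightarrow> bool" where
  "right_equivalent G L x x' \<longleftrightarrow>
     same_fibre G L x x' \<and> right_trans G L x x' \<and> right_trans G L x' x"

definition left_equivalent ::
  "('v, 'e) pre_digraph \<Rightarrow> ('e \<Rightarrow> 'c) \<Rightarrow> (int \<Rightarrow> 'e) \<Rightarrow> (int \<Rightarrow> 'e) \<Rightarrow> bool" where
  "left_equivalent G L x x' \<longleftrightarrow>
     same_fibre G L x x' \<and> left_trans G L x x' \<and> left_trans G L x' x"

definition right_class ::
  "('v, 'e) pre_digraph \<Rightarrow> ('e \<Rightarrow> 'c) \<Rightarrow> (int \<Rightarrow> 'e) \<Rightarrow> (int \<Rightarrow> 'e) set" where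
  "right_class G L x = {x'. right_equivalent G L x x'}"

definition left_class ::
  "('v, 'e) pre_digraph \<Rightarrow> ('e \<Rightarrow> 'c) \<Rightarrow> (int \<Rightarrow> 'e) \<Rightarrow> (int \<Rightarrow> 'e) set" where
  "left_class G L x = {x'. left_equivalent G L x x'}"

definition right_classes_over ::
  "('v, 'e) pre_digraph \<Rightarrow> ('e \<Rightarrow> 'c) \<Rightarrow> (int \<Rightarrow> 'c) \<Rightarrow> (int \<Rightarrow> 'e) set set" where
  "right_classes_over G L y = right_class G L ` {x \<in> edge_shift G. block_map L x = y}"

definition right_class_closing :: "('v, 'e) pre_digraph \<Rightarrow> ('e \<Rightarrow> 'c) \<Rightarrow> bool" where
  "right_class_closing G L \<longleftrightarrow>
     (\<forall>x \<in> edge_shift G. \<forall>x' \<in> edge_shift G.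
        block_map L x = block_map L x' \<and> left_asymptotic x x' \<longrightarrow> right_equivalent G L x x')"


section \<open>Tangled sets and accessibility\<close>

definition bridge ::
  "('v, 'e) pre_digraph \<Rightarrow> ('e \<Rightarrow> 'c) \<Rightarrow> 'e list \<Rightarrow> 'e list \<Rightarrow> 'e list \<Rightarrow> bool" where
  "bridge G L u w v \<longleftrightarrow>
     v \<in> paths G \<and> length v = length u \<and> length v = length w \<and>
     hd v = hd u \<and> last v = last w \<and> map L v = map L u \<and> map L v = map L w"

definition tangled :: "('v, 'e) pre_digraph \<Rightarrow> ('e \<Rightarrow> 'c) \<Rightarrow> 'e list set \<Rightarrow> bool" where
  "tangled G L \<Gamma> \<longleftrightarrow>
     \<Gamma> \<subseteq> paths G \<and> same_label L \<Gamma> \<and>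
     (\<forall>u \<in> \<Gamma>. \<forall>w \<in> \<Gamma>. (\<exists>v. bridge G L u w v) \<and> (\<exists>v. bridge G L w u v))"

definition terminals_from ::
  "('v, 'e) pre_digraph \<Rightarrow> ('e \<Rightarrow> 'c) \<Rightarrow> 'v \<Rightarrow> 'c list \<Rightarrow> 'v set" where
  "terminals_from G L I v = {J. \<exists>p. pre_digraph.awalk G I p J \<and> map L p = v}"

definition right_accessible ::
  "('v, 'e) pre_digraph \<Rightarrow> ('e \<Rightarrow> 'c) \<Rightarrow> 'v \<Rightarrow> 'e list set \<Rightarrow> bool" where
  "right_accessible G L I \<Gamma> \<longleftrightarrow>
     (\<exists>v \<in> language (block_map L ` edge_shift G).
        initial_vertices G \<Gamma> \<subseteq> terminals_from G L I v)"

definition starting_sets_tangled :: "('v, 'e) pre_digraph \<Rightarrow> ('e \<Rightarrow> 'c) \<Rightarrow> nat \<Rightarrow> bool" where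
  "starting_sets_tangled G L D \<longleftrightarrow>
     (\<forall>I \<in> verts G. \<forall>\<Gamma>.
        (\<forall>p \<in> \<Gamma>. length p = D + 1 \<and> (\<exists>J. pre_digraph.awalk G I p J)) \<and>
        same_label L \<Gamma>
        \<longrightarrow> tangled G L \<Gamma>)"

definition accessible_sets_tangled :: "('v, 'e) pre_digraph \<Rightarrow> ('e \<Rightarrow> 'c) \<Rightarrow> nat \<Rightarrow> bool" where
  "accessible_sets_tangled G L D \<longleftrightarrow>
     (\<forall>I \<in> verts G. \<forall>\<Gamma>.
        \<Gamma> \<subseteq> {p \<in> paths G. length p = D + 1} \<and>
        same_label L \<Gamma> \<and> right_accessible G L I \<Gamma>
        \<longrightarrow> tangled G L \<Gamma>)"

end

theory Submission
  imports Defs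
begin

text \<open>
  A right bridge may take its time to join the second point, so bridges between right asymptotic
  points cost nothing: the first point is itself a bridge, and right asymptotic points of one
  fibre are right equivalent. The closing property adds the same for left asymptotic points.
  Together they show that two points \<open>x\<close> and \<open>x'\<close> of a fibre are right
  equivalent as soon as some point of the fibre follows \<open>x\<close> in the far past and
  \<open>x'\<close> in the far future (\<open>right_equivalent_via\<close>). Switching from
  \<open>x\<close> to \<open>x'\<close> at a symbol that they share produces such a point, and so
  does a left bridge; this gives separation of right classes and the inclusion of left classes in
  right classes. Both properties imply closing at once, since left asymptotic points share a
  symbol and are left equivalent.

  Tangledness is a finite form of closing. If all pairs of equally labelled paths of length
  \<open>D + 1\<close> from a common vertex are bridged, then so are the last \<open>D + 1\<close>
  arcs of longer pairs, whatever the length of the part that precedes them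
  (\<open>bridge_after_common_start\<close>). Read on accessible sets, whose members are the ends
  of such longer paths, this is the equivalence of the two tangledness conditions with the same
  \<open>D\<close>; read on the windows of two left asymptotic points, it yields right bridges at
  every position.

  Conversely, a bridge can be prolonged along its target, so the nonempty initial segments of a
  pair of paths without a bridge have no bridge either. If no \<open>D\<close> works, there are
  unbridged pairs of every length, and as there are finitely many arcs, some infinite pair of rays
  has all its initial segments unbridged (\<open>infinite_tree_has_branch\<close>). Irreducibility
  supplies a common past for the two rays, and the resulting left asymptotic points admit no right
  bridge at position \<open>0\<close>, which contradicts closing.
\<close>

section \<open>Paths as lists of arcs\<close>

lemma (in wf_digraph) awalk_nonempty_iff:
  assumes "p \<noteq> []"
  shows "awalk I p J \<longleftrightarrow> set p \<subseteq> arcs G \<and> successively (\<lambda>a b. head G a = tail G b) p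
           \<and> tail G (hd p) = I \<and> head G (last p) = J"
  using assms
proof (induction p arbitrary: I)
  case (Cons a p)
  show ?case
  proof (cases "p = []")
    case True
    then show ?thesis by (auto simp: awalk_Cons_iff awalk_Nil_iff)
  next
    case False
    then show ?thesis
      using Cons.IH[OF False, of "head G a"]
      by (auto simp: awalk_Cons_iff successively_Cons)
  qed
qed simp

lemma (in wf_digraph) paths_nonempty_iff:
  assumes "p \<noteq> []"
  shows "p \<in> paths G \<longleftrightarrow> set p \<subseteq> arcs G \<and> successively (\<lambda>a b. head G a = tail G b) p"
  using awalk_nonempty_iff[OF assms] by (auto simp: paths_def)

lemma (in wf_digraph) awalk_iff_paths:
  assumes "p \<noteq> []"
  shows "awalk I p J \<longleftrightarrow> p \<in> paths G \<and> tail G (hd p) = I \<and> head G (last p) = J"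
  using awalk_nonempty_iff[OF assms] paths_nonempty_iff[OF assms] by blast

lemma (in wf_digraph) paths_append_iff:
  assumes "u \<noteq> []" "w \<noteq> []"
  shows "u @ w \<in> paths G \<longleftrightarrow>
           u \<in> paths G \<and> w \<in> paths G \<and> head G (last u) = tail G (hd w)"
  using assms by (auto simp: paths_nonempty_iff successively_append_iff)

text \<open>
  A bridge ends with the last arc of its target, so it can be continued along the target.
  Contrapositively, a pair of equally labelled paths without a bridge has no bridge between
  nonempty initial segments of equal length.
\<close>

lemma (in wf_digraph) bridge_append:
  assumes b: "bridge G L u w v" and ne: "u \<noteq> []" "w \<noteq> []"
    and paths: "w @ w' \<in> paths G"
    and lab: "map L (u @ u') = map L (w @ w')"
  shows "bridge G L (u @ u') (w @ w') (v @ w')"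
proof -
  have vne: "v \<noteq> []" and len: "length u = length w"
    using b ne by (auto simp: bridge_def)
  then have lab': "map L u' = map L w'" using lab by simp
  then have len': "length u' = length w'" by (rule map_eq_imp_length_eq)
  have "v @ w' \<in> paths G"
  proof (cases "w' = []")
    case True
    then show ?thesis using b by (simp add: bridge_def)
  next
    case False
    then show ?thesis
      using paths b vne ne by (simp add: paths_append_iff bridge_def)
  qed
  moreover have "last (v @ w') = last (w @ w')"
    using b by (auto simp: bridge_def last_append)
  ultimately show ?thesis
    using b vne ne lab' len' by (auto simp: bridge_def)
qed


section \<open>Tangled starting sets\<close>

text \<open>
  Tangledness only constrains pairs, so it can be tested on sets with two members; the initial
  vertex of a nonempty path is the tail of its first arc.
\<close>

lemma (in wf_digraph) starting_sets_tangled_iff: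
  "starting_sets_tangled G L D \<longleftrightarrow>
     (\<forall>u \<in> paths G. \<forall>w \<in> paths G. length u = D + 1 \<and> tail G (hd u) = tail G (hd w)
        \<and> map L u = map L w \<longrightarrow> (\<exists>v. bridge G L u w v))"
  (is "?S \<longleftrightarrow> ?B")
proof
  assume S: ?S
  show ?B
  proof (intro ballI impI, elim conjE)
    fix u w assume u: "u \<in> paths G" and w: "w \<in> paths G" and len: "length u = D + 1"
      and start: "tail G (hd u) = tail G (hd w)" and lab: "map L u = map L w"
    have ne: "u \<noteq> []" "w \<noteq> []" and lenw: "length w = D + 1"
      using len lab map_eq_imp_length_eq[OF lab] by auto
    have "tail G (hd u) \<in> verts G" using u ne by (auto simp: paths_nonempty_iff intro!: tail_in_verts)
    moreover have "\<forall>p \<in> {u, w}. length p = D + 1 \<and> (\<exists>J. awalk (tail G (hd u)) p J)"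
      using u w ne lenw start by (auto simp: len awalk_iff_paths)
    moreover have "same_label L {u, w}" using lab by (simp add: same_label_def)
    ultimately have "tangled G L {u, w}"
      using S unfolding starting_sets_tangled_def by blast
    then show "\<exists>v. bridge G L u w v" by (simp add: tangled_def)
  qed
next
  assume B: ?B
  show ?S unfolding starting_sets_tangled_def
  proof (intro ballI allI impI, elim conjE)
    fix I \<Gamma>
    assume \<Gamma>: "\<forall>p\<in>\<Gamma>. length p = D + 1 \<and> (\<exists>J. awalk I p J)" and lab: "same_label L \<Gamma>"
    have p: "p \<in> paths G \<and> tail G (hd p) = I \<and> length p = D + 1" if "p \<in> \<Gamma>" for p
    proof -
      have "p \<noteq> []" using \<Gamma> that by force
      then show ?thesis using \<Gamma> that by (auto simp: awalk_iff_paths)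
    qed
    have "\<exists>v. bridge G L u w v" if "u \<in> \<Gamma>" "w \<in> \<Gamma>" for u w
    proof -
      have "map L u = map L w" using lab that unfolding same_label_def by blast
      then show ?thesis using B p[OF that(1)] p[OF that(2)] by simp
    qed
    then show "tangled G L \<Gamma>" using p lab by (auto simp: tangled_def)
  qed
qed

text \<open>
  The step is what makes tangledness propagate along arbitrarily long paths. Suppose that
  \<open>p\<close> and \<open>q\<close> start at the same vertex. A bridge between their first
  \<open>D + 1\<close> arcs, prolonged along \<open>q\<close>, is a path \<open>s\<close> that
  shares its first arc with \<open>p\<close> and its last arc with \<open>q\<close>. Deleting the
  common first arc of \<open>p\<close> and \<open>s\<close> leaves two paths with a common start
  again, shorter by one.
\<close>

lemma (in wf_digraph) bridge_after_common_start:
  assumes S: "starting_sets_tangled G L D"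
    and "p \<in> paths G" "q \<in> paths G" "tail G (hd p) = tail G (hd q)" "map L p = map L q"
    and "length p = n + D + 1"
  shows "\<exists>v. bridge G L (drop n p) (drop n q) v"
  using assms(2-)
proof (induction n arbitrary: p q)
  case 0
  then show ?case using S by (simp add: starting_sets_tangled_iff)
next
  case (Suc n)
  let ?k = "D + 1"
  have lenq: "length q = Suc n + D + 1"
    using Suc.prems(5) map_eq_imp_length_eq[OF Suc.prems(4)] by simp
  have ne: "take ?k p \<noteq> []" "take ?k q \<noteq> []" "drop ?k p \<noteq> []" "drop ?k q \<noteq> []"
    "p \<noteq> []" "q \<noteq> []"
    using Suc.prems(5) lenq by auto
  have "take ?k p \<in> paths G" "take ?k q \<in> paths G"
    using ne Suc.prems(1,2) paths_append_iff[of "take ?k p" "drop ?k p"]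
      paths_append_iff[of "take ?k q" "drop ?k q"] by simp_all
  moreover have "map L (take ?k p) = map L (take ?k q)"
    using Suc.prems(4) by (metis take_map)
  moreover have "tail G (hd (take ?k p)) = tail G (hd (take ?k q))"
    using Suc.prems(3) by simp
  moreover have "length (take ?k p) = D + 1" using Suc.prems(5) by simp
  ultimately obtain r where r: "bridge G L (take ?k p) (take ?k q) r"
    using S unfolding starting_sets_tangled_iff by blast
  define s where "s = r @ drop ?k q"
  have s: "bridge G L p q s"
    using bridge_append[OF r ne(1,2), of "drop ?k q" "drop ?k p"] Suc.prems(2,4)
    by (simp add: s_def)
  then have slen: "length s = Suc n + D + 1" using lenq by (simp add: bridge_def)
  obtain a p' where p: "p = a # p'" using ne by (cases p) auto
  obtain s' where s': "s = a # s'" using s slen p by (cases s) (auto simp: bridge_def)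
  have ne': "p' \<noteq> []" "s' \<noteq> []" using p s' slen Suc.prems(5) by auto
  have "p' \<in> paths G" "s' \<in> paths G" "tail G (hd p') = tail G (hd s')"
    using paths_append_iff[of "[a]" p'] paths_append_iff[of "[a]" s'] ne' p s' s Suc.prems(1)
    by (simp_all add: bridge_def)
  moreover have "map L p' = map L s'" using s p s' by (simp add: bridge_def)
  ultimately obtain v where v: "bridge G L (drop n p') (drop n s') v"
    using Suc.IH[of p' s'] Suc.prems(5) p by auto
  have "last (drop n s') = last (drop (Suc n) q)"
    using s s' slen ne' lenq by (simp add: bridge_def)
  moreover have "map L (drop n s') = map L (drop (Suc n) q)"
  proof -
    have "map L (drop (Suc n) s) = map L (drop (Suc n) q)"
      using s by (metis bridge_def drop_map)
    then show ?thesis using s' by simp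
  qed
  moreover have "drop (Suc n) p = drop n p'" using p by simp
  moreover from this have "map L (drop n p') = map L (drop (Suc n) q)"
    using Suc.prems(4) by (metis drop_map)
  ultimately have "bridge G L (drop (Suc n) p) (drop (Suc n) q) v"
    using v slen s' lenq unfolding bridge_def by simp
  then show ?case by blast
qed

text \<open>
  Members of a set that is accessible from \<open>I\<close> via \<open>v\<close>, prefixed by
  suitable paths labelled \<open>v\<close>, become equally labelled paths from \<open>I\<close>.
  The original members are what remains after \<open>length v\<close> arcs.
\<close>

lemma (in wf_digraph) starting_sets_tangled_iff_accessible:
  "starting_sets_tangled G L D \<longleftrightarrow> accessible_sets_tangled G L D"
proof
  assume S: "starting_sets_tangled G L D"
  show "accessible_sets_tangled G L D" unfolding accessible_sets_tangled_def
  proof (intro ballI allI impI, elim conjE)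
    fix I \<Gamma>
    assume \<Gamma>: "\<Gamma> \<subseteq> {p \<in> paths G. length p = D + 1}" and lab: "same_label L \<Gamma>"
      and "right_accessible G L I \<Gamma>"
    then obtain v where v: "initial_vertices G \<Gamma> \<subseteq> terminals_from G L I v"
      unfolding right_accessible_def by blast
    have ext: "\<exists>p. map L p = v \<and> p @ u \<in> paths G \<and> tail G (hd (p @ u)) = I" if u: "u \<in> \<Gamma>" for u
    proof -
      have ne: "u \<noteq> []" and "u \<in> paths G" using \<Gamma> u by auto
      then obtain J where J: "awalk (tail G (hd u)) u J" by (simp add: awalk_iff_paths)
      then have "tail G (hd u) \<in> initial_vertices G \<Gamma>"
        using u by (auto simp: initial_vertices_def)
      then obtain p where p: "awalk I p (tail G (hd u))" "map L p = v"
        using v by (auto simp: terminals_from_def)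
      then have "awalk I (p @ u) J" using J by auto
      then have "p @ u \<in> paths G \<and> tail G (hd (p @ u)) = I"
        using ne by (simp add: awalk_iff_paths del: awalk_append_iff)
      then show ?thesis using p(2) by blast
    qed
    have "\<exists>r. bridge G L u w r" if uw: "u \<in> \<Gamma>" "w \<in> \<Gamma>" for u w
    proof -
      obtain p where p: "map L p = v" "p @ u \<in> paths G" "tail G (hd (p @ u)) = I"
        using ext[OF uw(1)] by blast
      obtain q where q: "map L q = v" "q @ w \<in> paths G" "tail G (hd (q @ w)) = I"
        using ext[OF uw(2)] by blast
      have "map L u = map L w" using lab uw unfolding same_label_def by blast
      then have "map L (p @ u) = map L (q @ w)" using p(1) q(1) by simp
      moreover have len: "length p = length v" "length q = length v" "length u = D + 1"
        using arg_cong[OF p(1), of length] arg_cong[OF q(1), of length] \<Gamma> uw by auto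
      ultimately have "\<exists>r. bridge G L (drop (length v) (p @ u)) (drop (length v) (q @ w)) r"
        using p q by (intro bridge_after_common_start[OF S]) auto
      then show ?thesis using len by simp
    qed
    then show "tangled G L \<Gamma>" using \<Gamma> lab by (auto simp: tangled_def)
  qed
next
  assume A: "accessible_sets_tangled G L D"
  show "starting_sets_tangled G L D" unfolding starting_sets_tangled_def
  proof (intro ballI allI impI, elim conjE)
    fix I \<Gamma>
    assume I: "I \<in> verts G" and \<Gamma>: "\<forall>p\<in>\<Gamma>. length p = D + 1 \<and> (\<exists>J. awalk I p J)"
      and lab: "same_label L \<Gamma>"
    \<comment> \<open>\<open>I\<close> is accessible from itself via the empty word.\<close>
    have "I' = I" if "p \<in> \<Gamma>" "awalk I' p J" for I' p J
    proof -
      have "p \<noteq> []" using \<Gamma> that by force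
      then show ?thesis using \<Gamma> that by (metis awalk_iff_paths)
    qed
    then have "initial_vertices G \<Gamma> \<subseteq> {I}" by (auto simp: initial_vertices_def)
    also have "\<dots> \<subseteq> terminals_from G L I []"
      using I by (auto simp: terminals_from_def awalk_Nil_iff)
    finally have "right_accessible G L I \<Gamma>"
      unfolding right_accessible_def language_def by blast
    moreover have "\<Gamma> \<subseteq> {p \<in> paths G. length p = D + 1}" using \<Gamma> by (auto simp: paths_def)
    ultimately show "tangled G L \<Gamma>"
      using A I lab unfolding accessible_sets_tangled_def by blast
  qed
qed


section \<open>Right and left equivalence\<close>

text \<open>
  At a common arc one point may be abandoned for another. Bridges are concatenated in this way.
\<close>

lemma edge_shift_glue:
  assumes "x \<in> edge_shift G" "x' \<in> edge_shift G" "x k = x' k"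
  shows "(\<lambda>i. if i \<le> k then x i else x' i) \<in> edge_shift G"
proof -
  have "head G (x i) = tail G (x' (i + 1))" if "i \<le> k" "\<not> i + 1 \<le> k" for i
  proof -
    have "i = k" using that by simp
    then show ?thesis using assms by (simp add: edge_shift_def)
  qed
  then show ?thesis using assms by (auto simp: edge_shift_def)
qed

lemma block_map_glue:
  assumes "block_map L x = y" "block_map L x' = y"
  shows "block_map L (\<lambda>i. if i \<le> k then x i else x' i) = y"
  using assms by (auto simp: block_map_def fun_eq_iff)

lemma left_asymptotic_sym: "left_asymptotic x x' \<Longrightarrow> left_asymptotic x' x"
  unfolding left_asymptotic_def by (simp only: eq_commute[of "x _" "x' _"])

lemma right_trans_if_right_asymptotic:
  assumes "same_fibre G L x x'" "\<forall>i \<ge> k. x i = x' i"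
  shows "right_trans G L x x'"
  unfolding right_trans_def
proof
  fix m
  have "right_bridge G L m x x' x"
    using assms unfolding right_bridge_def same_fibre_def
    by (intro conjI exI[of _ "max k (m + 1)"]) auto
  then show "\<exists>z. right_bridge G L m x x' z" by blast
qed

lemma right_equivalent_if_right_asymptotic:
  assumes "same_fibre G L x x'" "\<forall>i \<ge> k. x i = x' i"
  shows "right_equivalent G L x x'"
  using assms right_trans_if_right_asymptotic[of G L x x' k]
    right_trans_if_right_asymptotic[of G L x' x k]
  by (simp add: right_equivalent_def same_fibre_def)

lemma left_trans_if_left_asymptotic:
  assumes "same_fibre G L x x'" "\<forall>i \<le> k. x i = x' i"
  shows "left_trans G L x x'"
  unfolding left_trans_def
proof
  fix m
  have "left_bridge G L m x x' x"
    using assms unfolding left_bridge_def same_fibre_def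
    by (intro conjI exI[of _ "min k (m - 1)"]) auto
  then show "\<exists>z. left_bridge G L m x x' z" by blast
qed

lemma left_equivalent_if_left_asymptotic:
  assumes "same_fibre G L x x'" "left_asymptotic x x'"
  shows "left_equivalent G L x x'"
proof -
  obtain k where "\<forall>i \<le> k. x i = x' i" using assms(2) by (auto simp: left_asymptotic_def)
  then show ?thesis
    using assms left_trans_if_left_asymptotic[of G L x x' k]
      left_trans_if_left_asymptotic[of G L x' x k]
    by (simp add: left_equivalent_def same_fibre_def)
qed

lemma right_trans_trans:
  assumes "right_trans G L x x'" "right_trans G L x' x''" "block_map L x = block_map L x'"
  shows "right_trans G L x x''"
  unfolding right_trans_def
proof
  fix m
  obtain z n where z: "z \<in> edge_shift G" "block_map L z = block_map L x" "m < n"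
    "\<forall>i \<le> m. z i = x i" "\<forall>i \<ge> n. z i = x' i"
    using assms(1) unfolding right_trans_def right_bridge_def by blast
  obtain z' n' where z': "z' \<in> edge_shift G" "block_map L z' = block_map L x'" "n < n'"
    "\<forall>i \<le> n. z' i = x' i" "\<forall>i \<ge> n'. z' i = x'' i"
    using assms(2) unfolding right_trans_def right_bridge_def by blast
  have "z n = z' n" using z z' by simp
  then have "right_bridge G L m x x'' (\<lambda>i. if i \<le> n then z i else z' i)"
    using z z' assms(3) unfolding right_bridge_def
    by (intro conjI exI[of _ n'] edge_shift_glue block_map_glue) auto
  then show "\<exists>z. right_bridge G L m x x'' z" by blast
qed

lemma left_trans_trans:
  assumes "left_trans G L x x'" "left_trans G L x' x''" "block_map L x = block_map L x'"
  shows "left_trans G L x x''"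
  unfolding left_trans_def
proof
  fix m
  obtain z n where z: "z \<in> edge_shift G" "block_map L z = block_map L x" "n < m"
    "\<forall>i \<le> n. z i = x' i" "\<forall>i \<ge> m. z i = x i"
    using assms(1) unfolding left_trans_def left_bridge_def by blast
  obtain z' n' where z': "z' \<in> edge_shift G" "block_map L z' = block_map L x'" "n' < n"
    "\<forall>i \<le> n'. z' i = x'' i" "\<forall>i \<ge> n. z' i = x' i"
    using assms(2) unfolding left_trans_def left_bridge_def by blast
  have "z' n = z n" using z z' by simp
  then have "left_bridge G L m x x'' (\<lambda>i. if i \<le> n then z' i else z i)"
    using z z' assms(3) unfolding left_bridge_def
    by (intro conjI exI[of _ n'] edge_shift_glue block_map_glue) auto
  then show "\<exists>z. left_bridge G L m x x'' z" by blast
qed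

lemma right_equivalent_sym: "right_equivalent G L x x' \<Longrightarrow> right_equivalent G L x' x"
  by (auto simp: right_equivalent_def same_fibre_def)

lemma left_equivalent_sym: "left_equivalent G L x x' \<Longrightarrow> left_equivalent G L x' x"
  by (auto simp: left_equivalent_def same_fibre_def)

lemma right_equivalent_trans:
  assumes "right_equivalent G L x x'" "right_equivalent G L x' x''"
  shows "right_equivalent G L x x''"
  using assms right_trans_trans[of G L x x' x''] right_trans_trans[of G L x'' x' x]
  by (simp add: right_equivalent_def same_fibre_def)

lemma left_equivalent_trans:
  assumes "left_equivalent G L x x'" "left_equivalent G L x' x''"
  shows "left_equivalent G L x x''"
  using assms left_trans_trans[of G L x x' x''] left_trans_trans[of G L x'' x' x]
  by (simp add: left_equivalent_def same_fibre_def)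

lemma right_equivalent_refl: "x \<in> edge_shift G \<Longrightarrow> right_equivalent G L x x"
  by (rule right_equivalent_if_right_asymptotic) (auto simp: same_fibre_def)

lemma left_equivalent_refl: "x \<in> edge_shift G \<Longrightarrow> left_equivalent G L x x"
  by (rule left_equivalent_if_left_asymptotic) (auto simp: same_fibre_def left_asymptotic_def)

lemma right_class_eq: "right_equivalent G L x x' \<Longrightarrow> right_class G L x = right_class G L x'"
  unfolding right_class_def by (blast intro: right_equivalent_trans right_equivalent_sym)

lemma left_class_eq: "left_equivalent G L x x' \<Longrightarrow> left_class G L x = left_class G L x'"
  unfolding left_class_def by (blast intro: left_equivalent_trans left_equivalent_sym)


section \<open>Class-closing codes and classes\<close>

text \<open>
  The point that follows \<open>x\<close> in the far past and \<open>x'\<close> in the far future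
  links the two: it is right equivalent to \<open>x\<close> by the closing property, and to
  \<open>x'\<close> because bridges between right asymptotic points always exist.
\<close>

lemma right_equivalent_via:
  assumes C: "right_class_closing G L"
    and fib: "same_fibre G L x z" "same_fibre G L z x'"
    and past: "left_asymptotic x z" and future: "\<forall>i \<ge> k. z i = x' i"
  shows "right_equivalent G L x x'"
proof -
  have "right_equivalent G L x z"
    using C fib past by (simp add: right_class_closing_def same_fibre_def)
  moreover have "right_equivalent G L z x'"
    using fib(2) future by (rule right_equivalent_if_right_asymptotic)
  ultimately show ?thesis by (rule right_equivalent_trans)
qed

lemma right_class_closing_iff_separated:
  "right_class_closing G L \<longleftrightarrow>
     (\<forall>y \<in> block_map L ` edge_shift G. \<forall>C \<in> right_classes_over G L y.
        \<forall>C' \<in> right_classes_over G L y.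
           C \<noteq> C' \<longrightarrow> (\<forall>x \<in> C. \<forall>x' \<in> C'. mutually_separated x x'))" (is "_ \<longleftrightarrow> ?S")
proof
  assume C: "right_class_closing G L"
  have common_symbol: "right_class G L a = right_class G L a'"
    if a: "block_map L a = block_map L a'"
      and x: "right_equivalent G L a x" and x': "right_equivalent G L a' x'"
      and i: "x i = x' i" for a a' x x' i
  proof -
    define z where "z = (\<lambda>j. if j \<le> i then x j else x' j)"
    have f: "same_fibre G L x x'"
      using a x x' by (simp add: right_equivalent_def same_fibre_def)
    then have "z \<in> edge_shift G" "block_map L z = block_map L x'"
      using edge_shift_glue i block_map_glue unfolding z_def same_fibre_def by metis+
    then have "same_fibre G L x z" "same_fibre G L z x'"
      using f by (auto simp: same_fibre_def)
    moreover have "left_asymptotic x z" "\<forall>j \<ge> i + 1. z j = x' j"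
      by (auto simp: left_asymptotic_def z_def)
    ultimately have "right_equivalent G L x x'" by (rule right_equivalent_via[OF C])
    then have "right_class G L x = right_class G L x'" by (rule right_class_eq)
    then show ?thesis using right_class_eq[OF x] right_class_eq[OF x'] by simp
  qed
  show ?S
    unfolding right_classes_over_def
  proof (intro ballI impI)
    fix y C C' x x'
    assume C: "C \<in> right_class G L ` {x \<in> edge_shift G. block_map L x = y}"
        "C' \<in> right_class G L ` {x \<in> edge_shift G. block_map L x = y}"
      and ne: "C \<noteq> C'" and x: "x \<in> C" "x' \<in> C'"
    obtain a where a: "C = right_class G L a" "block_map L a = y" using C(1) by blast
    obtain a' where a': "C' = right_class G L a'" "block_map L a' = y" using C(2) by blast
    have "x i \<noteq> x' i" for i
      using common_symbol[of a a' x x' i] a a' ne x by (auto simp: right_class_def)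
    then show "mutually_separated x x'" by (simp add: mutually_separated_def)
  qed
next
  assume S: ?S
  show "right_class_closing G L"
    unfolding right_class_closing_def
  proof (intro ballI impI, elim conjE)
    fix x x' assume x: "x \<in> edge_shift G" "x' \<in> edge_shift G" "block_map L x = block_map L x'"
      and "left_asymptotic x x'"
    then have ns: "\<not> mutually_separated x x'"
      by (auto simp: left_asymptotic_def mutually_separated_def)
    have m: "x \<in> right_class G L x" "x' \<in> right_class G L x'"
      using x right_equivalent_refl by (auto simp: right_class_def)
    have "right_class G L x \<in> right_classes_over G L (block_map L x)"
      "right_class G L x' \<in> right_classes_over G L (block_map L x)"
      using x by (auto simp: right_classes_over_def)
    then have "right_class G L x = right_class G L x'" using S x(1) m ns by blast
    then show "right_equivalent G L x x'" using m by (auto simp: right_class_def)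
  qed
qed

lemma right_class_closing_iff_left_class_subset:
  "right_class_closing G L \<longleftrightarrow> (\<forall>x \<in> edge_shift G. left_class G L x \<subseteq> right_class G L x)"
proof
  assume C: "right_class_closing G L"
  show "\<forall>x \<in> edge_shift G. left_class G L x \<subseteq> right_class G L x"
  proof (intro ballI subsetI)
    fix x x' assume "x' \<in> left_class G L x"
    then have f: "same_fibre G L x x'" and "left_trans G L x' x"
      by (auto simp: left_class_def left_equivalent_def)
    \<comment> \<open>A single bridge suffices; its position \<open>0\<close> is arbitrary.\<close>
    then obtain z n where z: "z \<in> edge_shift G" "block_map L z = block_map L x'"
      "\<forall>i \<le> n. z i = x i" "\<forall>i \<ge> 0. z i = x' i"
      unfolding left_trans_def left_bridge_def by blast
    have "same_fibre G L x z" "same_fibre G L z x'" using z f by (auto simp: same_fibre_def)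
    moreover have "left_asymptotic z x" using z(3) unfolding left_asymptotic_def by blast
    then have "left_asymptotic x z" by (rule left_asymptotic_sym)
    ultimately have "right_equivalent G L x x'" using z(4) by (rule right_equivalent_via[OF C])
    then show "x' \<in> right_class G L x" by (simp add: right_class_def)
  qed
next
  assume S: "\<forall>x \<in> edge_shift G. left_class G L x \<subseteq> right_class G L x"
  show "right_class_closing G L"
    unfolding right_class_closing_def
  proof (intro ballI impI, elim conjE)
    fix x x' assume x: "x \<in> edge_shift G" "x' \<in> edge_shift G" "block_map L x = block_map L x'"
      and "left_asymptotic x x'"
    then have "x' \<in> left_class G L x"
      by (simp add: left_class_def left_equivalent_if_left_asymptotic same_fibre_def)
    then show "right_equivalent G L x x'" using S x(1) by (auto simp: right_class_def)
  qed
qed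

text \<open>
  Left classes partition a fibre, so a right class that is a union of left classes contains with
  each point its whole left class.
\<close>

lemma left_class_subset_iff_union:
  "(\<forall>x \<in> edge_shift G. left_class G L x \<subseteq> right_class G L x) \<longleftrightarrow>
   (\<forall>x \<in> edge_shift G. \<exists>S \<subseteq> left_class G L ` edge_shift G. right_class G L x = \<Union>S)"
  (is "?A \<longleftrightarrow> ?B")
proof
  assume A: ?A
  show ?B
  proof
    fix x assume "x \<in> edge_shift G"
    have sub: "right_class G L x \<subseteq> edge_shift G"
      by (auto simp: right_class_def right_equivalent_def same_fibre_def)
    have "left_class G L x' \<subseteq> right_class G L x" if "x' \<in> right_class G L x" for x'
      using A sub that right_class_eq[of G L x x'] by (auto simp: right_class_def)
    moreover have "x' \<in> left_class G L x'" if "x' \<in> right_class G L x" for x'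
      using sub that left_equivalent_refl by (auto simp: left_class_def)
    ultimately have "right_class G L x = \<Union>(left_class G L ` right_class G L x)" by blast
    moreover have "left_class G L ` right_class G L x \<subseteq> left_class G L ` edge_shift G"
      using sub by (rule image_mono)
    ultimately show "\<exists>S \<subseteq> left_class G L ` edge_shift G. right_class G L x = \<Union>S"
      by (intro exI conjI)
  qed
next
  assume B: ?B
  show ?A
  proof
    fix x assume x: "x \<in> edge_shift G"
    then obtain S where S: "S \<subseteq> left_class G L ` edge_shift G" "right_class G L x = \<Union>S"
      using bspec[OF B x] by (elim exE conjE)
    have "x \<in> right_class G L x" using x right_equivalent_refl by (simp add: right_class_def)
    then have "x \<in> \<Union>S" by (simp only: S(2))
    then obtain C where C: "C \<in> S" "x \<in> C" by (rule UnionE)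
    from subsetD[OF S(1) C(1)] obtain w where w: "C = left_class G L w" by (rule imageE)
    have "left_equivalent G L w x" using C(2) w by (simp add: left_class_def)
    then have "left_class G L x = C" using w left_class_eq[of G L w x] by simp
    then show "left_class G L x \<subseteq> right_class G L x"
      unfolding S(2) using C(1) by (simp add: Union_upper)
  qed
qed


section \<open>Windows of points\<close>

definition window :: "(int \<Rightarrow> 'e) \<Rightarrow> int \<Rightarrow> nat \<Rightarrow> 'e list" where
  "window x m n = map (\<lambda>k. x (m + int k)) [0..<n]"

lemma length_window [simp]: "length (window x m n) = n"
  by (simp add: window_def)

lemma nth_window [simp]: "k < n \<Longrightarrow> window x m n ! k = x (m + int k)"
  by (simp add: window_def)

lemma hd_window [simp]: "hd (window x m (Suc n)) = x m"
  by (simp add: hd_conv_nth flip: length_greater_0_conv)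

lemma last_window [simp]: "last (window x m (Suc n)) = x (m + int n)"
  by (simp add: last_conv_nth flip: length_greater_0_conv)

lemma map_window: "map L (window x m n) = window (block_map L x) m n"
  by (simp add: window_def block_map_def)

lemma drop_window: "drop k (window x m (k + n)) = window x (m + int k) n"
  by (rule nth_equalityI) (auto simp: algebra_simps)

lemma (in wf_digraph) window_in_paths:
  assumes "x \<in> edge_shift G"
  shows "window x m (Suc n) \<in> paths G"
proof -
  have "window x m (Suc n) \<noteq> []" by (simp flip: length_greater_0_conv)
  moreover have "head G (x i) = tail G (x j)" if "j = i + 1" for i j
    using assms that by (simp add: edge_shift_def)
  moreover have "set (window x m (Suc n)) \<subseteq> arcs G"
    using assms by (auto simp: window_def edge_shift_def)
  ultimately show ?thesis by (auto simp: paths_nonempty_iff successively_conv_nth add_ac)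
qed

text \<open>
  A bridge between windows of \<open>x\<close> and \<open>x'\<close> can be inserted between the
  past of \<open>x\<close> and the future of \<open>x'\<close>, because it repeats the arcs of
  \<open>x\<close> and \<open>x'\<close> at its ends.
\<close>

lemma (in wf_digraph) right_bridge_if_bridge:
  assumes f: "same_fibre G L x x'"
    and r: "bridge G L (window x m (Suc n)) (window x' m (Suc n)) r"
  shows "\<exists>z. right_bridge G L m x x' z"
proof -
  have len: "length r = Suc n" and rne: "r \<noteq> []"
    and hd: "r ! 0 = x m" and last: "r ! n = x' (m + int n)"
    using r by (auto simp: bridge_def hd_conv_nth last_conv_nth simp flip: length_greater_0_conv)
  have rp: "set r \<subseteq> arcs G" "\<And>k. Suc k < length r \<Longrightarrow> head G (r ! k) = tail G (r ! Suc k)"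
    using r rne by (auto simp: bridge_def paths_nonempty_iff successively_conv_nth)
  have lab: "L (r ! k) = L (x (m + int k))" if "k < Suc n" for k
  proof -
    have "map L r ! k = map L (window x m (Suc n)) ! k" using r by (simp add: bridge_def)
    then show ?thesis using that len by simp
  qed
  have x: "x i \<in> arcs G" "head G (x i) = tail G (x (i + 1))"
    "x' i \<in> arcs G" "head G (x' i) = tail G (x' (i + 1))" "L (x i) = L (x' i)" for i
    using f by (auto simp: same_fibre_def edge_shift_def block_map_def fun_eq_iff)
  \<comment> \<open>The path \<open>r\<close> occupies the positions from \<open>m\<close> to \<open>m + n\<close>.\<close>
  define z where "z i = (if i < m then x i else if i \<le> m + int n then r ! nat (i - m) else x' i)"
    for i
  have "z i \<in> arcs G" for i
    using x rp(1) len by (auto simp: z_def intro!: subsetD[OF rp(1)] nth_mem)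
  moreover have "head G (z i) = tail G (z (i + 1))" for i
  proof -
    consider "i + 1 < m" | "i + 1 = m" | "m \<le> i" "i < m + int n" | "i = m + int n" | "m + int n < i"
      by linarith
    then show ?thesis
    proof cases
      case 3
      then have "nat (i + 1 - m) = Suc (nat (i - m))" by simp
      then show ?thesis using 3 rp(2)[of "nat (i - m)"] len by (simp add: z_def)
    qed (use x hd last in \<open>auto simp: z_def\<close>)
  qed
  moreover have "L (z i) = L (x i)" for i
    using x lab[of "nat (i - m)"] by (auto simp: z_def)
  moreover have "z i = x i" if "i \<le> m" for i
    using that hd by (auto simp: z_def)
  moreover have "z i = x' i" if "i \<ge> m + int n + 1" for i
    using that by (simp add: z_def)
  ultimately have "right_bridge G L m x x' z"
    unfolding right_bridge_def edge_shift_def block_map_def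
    by (auto intro!: exI[of _ "m + int n + 1"])
  then show ?thesis by blast
qed

lemma (in wf_digraph) bridge_if_right_bridge:
  assumes fib: "same_fibre G L x x'" and z: "right_bridge G L m x x' z"
  shows "\<exists>n v. bridge G L (window x m (Suc n)) (window x' m (Suc n)) v"
proof -
  obtain n where n: "m < n" "z m = x m" "z n = x' n"
    using z by (auto simp: right_bridge_def)
  have "bridge G L (window x m (Suc (nat (n - m)))) (window x' m (Suc (nat (n - m))))
          (window z m (Suc (nat (n - m))))"
    using n z fib
    by (auto simp: bridge_def map_window right_bridge_def same_fibre_def intro: window_in_paths)
  then show ?thesis by blast
qed

text \<open>
  Any position \<open>m\<close> has a position at or before it where the two points still agree,
  and windows of the two points that begin there start at a common vertex. Hence the uniform
  length \<open>D + 1\<close> suffices for bridges starting at any \<open>m\<close>, however far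
  \<open>m\<close> lies beyond the common past.
\<close>

lemma (in wf_digraph) right_trans_if_starting_sets_tangled:
  assumes S: "starting_sets_tangled G L D"
    and f: "same_fibre G L x x'" and a: "left_asymptotic x x'"
  shows "right_trans G L x x'"
  unfolding right_trans_def
proof
  fix m
  obtain k where k: "\<forall>i \<le> k. x i = x' i" using a by (auto simp: left_asymptotic_def)
  define n where "n = nat (m - min k m)"
  have nm: "min k m + int n = m" by (simp add: n_def)
  have "\<exists>v. bridge G L (drop n (window x (min k m) (n + Suc D)))
                       (drop n (window x' (min k m) (n + Suc D))) v"
    using f k by (intro bridge_after_common_start[OF S])
      (auto simp: same_fibre_def map_window intro: window_in_paths)
  then show "\<exists>z. right_bridge G L m x x' z"
    using right_bridge_if_bridge[OF f] unfolding drop_window nm by blast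
qed


section \<open>A compactness argument\<close>

text \<open>
  Koenig's lemma for a prefix-closed set of words over a finite alphabet. A word with infinitely
  many extensions in the set has a one-letter extension with the same property, since a finite
  union of finite sets is finite; the letters chosen in this way spell the branch.
\<close>

lemma infinite_tree_has_branch:
  fixes T :: "'a list set"
  assumes A: "finite A" "\<And>xs. xs \<in> T \<Longrightarrow> set xs \<subseteq> A"
    and pre: "\<And>xs ys. xs @ ys \<in> T \<Longrightarrow> xs \<in> T" and inf: "infinite T"
  obtains f :: "nat \<Rightarrow> 'a" where "\<And>n. map f [0..<n] \<in> T"
proof -
  define E where "E xs = {ys. xs @ ys \<in> T}" for xs
  have step: "\<exists>a. infinite (E (xs @ [a]))" if i: "infinite (E xs)" for xs
  proof (rule ccontr)
    assume "\<not> ?thesis"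
    then have "finite (insert [] (\<Union>a\<in>A. (#) a ` E (xs @ [a])))" using A(1) by auto
    moreover have "E xs \<subseteq> insert [] (\<Union>a\<in>A. (#) a ` E (xs @ [a]))"
    proof
      fix ys assume ys: "ys \<in> E xs"
      show "ys \<in> insert [] (\<Union>a\<in>A. (#) a ` E (xs @ [a]))"
      proof (cases ys)
        case (Cons a zs)
        then show ?thesis using ys A(2)[of "xs @ ys"] by (auto simp: E_def)
      qed simp
    qed
    ultimately show False using i finite_subset by blast
  qed
  have "\<exists>g. \<forall>n. (infinite (E (g n)) \<and> length (g n) = n) \<and> (\<exists>a. g (Suc n) = g n @ [a])"
  proof (rule dependent_nat_choice)
    show "\<exists>xs. infinite (E xs) \<and> length xs = 0"
      using inf by (intro exI[of _ "[]"]) (simp add: E_def)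
  next
    fix xs n assume "infinite (E xs) \<and> length xs = n"
    then show "\<exists>ys. (infinite (E ys) \<and> length ys = Suc n) \<and> (\<exists>a. ys = xs @ [a])"
      using step by (metis length_append_singleton)
  qed
  then obtain g where g: "\<And>n. infinite (E (g n))" "\<And>n. length (g n) = n"
    "\<And>n. \<exists>a. g (Suc n) = g n @ [a]" by blast
  define f where "f n = last (g (Suc n))" for n
  have "map f [0..<n] = g n" for n
  proof (induction n)
    case 0
    then show ?case using g(2)[of 0] by simp
  next
    case (Suc n)
    then show ?case using g(3)[of n] by (auto simp: f_def)
  qed
  moreover have "g n \<in> T" for n
  proof -
    have "E (g n) \<noteq> {}" using g(1) by (metis finite.emptyI)
    then show ?thesis using pre by (auto simp: E_def)
  qed
  ultimately show thesis using that by metis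
qed

text \<open>
  Once an irreducible graph has an arc \<open>e\<close>, every vertex has an incoming arc: the
  last arc of a path from the head of \<open>e\<close>, or \<open>e\<close> itself when that path
  is empty. A common past can therefore be built backwards. The arc \<open>h k\<close> sits
  \<open>k + 1\<close> steps before \<open>V\<close>.
\<close>

lemma (in wf_digraph) ex_left_infinite_path:
  assumes irr: "irreducible_graph G" and V: "V \<in> verts G" and e: "e \<in> arcs G"
  shows "\<exists>h :: nat \<Rightarrow> 'b. head G (h 0) = V \<and>
           (\<forall>k. h k \<in> arcs G \<and> head G (h (Suc k)) = tail G (h k))"
proof -
  have "\<exists>a \<in> arcs G. head G a = W" if W: "W \<in> verts G" for W
  proof -
    obtain p where p: "awalk (head G e) p W"
      using irr W head_in_verts[OF e] unfolding irreducible_graph_def by blast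
    show ?thesis
    proof (cases "p = []")
      case True
      then show ?thesis using p e by (auto simp: awalk_Nil_iff)
    next
      case False
      then show ?thesis using p by (auto simp: awalk_nonempty_iff intro!: bexI[of _ "last p"])
    qed
  qed
  then have "\<forall>W \<in> verts G. \<exists>a. a \<in> arcs G \<and> head G a = W" by blast
  from bchoice[OF this] obtain pred
    where pred: "\<And>W. W \<in> verts G \<Longrightarrow> pred W \<in> arcs G \<and> head G (pred W) = W" by blast
  define h where "h = rec_nat (pred V) (\<lambda>_ a. pred (tail G a))"
  have h: "h 0 = pred V" "h (Suc k) = pred (tail G (h k))" for k by (simp_all add: h_def)
  have "h k \<in> arcs G" for k by (induction k) (use pred V in \<open>auto simp: h\<close>)
  then show ?thesis using pred V by (intro exI[of _ h]) (auto simp: h)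
qed

lemma edge_shift_from_rays:
  assumes "\<And>k. h k \<in> arcs G" "\<And>k. head G (h (Suc k)) = tail G (h k)"
    and "\<And>k. r k \<in> arcs G" "\<And>k. head G (r k) = tail G (r (Suc k))"
    and "head G (h 0) = tail G (r 0)"
  shows "(\<lambda>i. if i < 0 then h (nat (- i - 1)) else r (nat i)) \<in> edge_shift G"
proof -
  have "head G (h (nat (- i - 1))) = tail G (h (nat (- (i + 1) - 1)))" if "i + 1 < 0" for i
  proof -
    have "nat (- i - 1) = Suc (nat (- (i + 1) - 1))" using that by simp
    then show ?thesis using assms(2) by simp
  qed
  moreover have "head G (r (nat i)) = tail G (r (nat (i + 1)))" if "i \<ge> 0" for i
    using assms(4)[of "nat i"] that by (simp add: Suc_nat_eq_nat_zadd1 add.commute)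
  moreover have "head G (h (nat (- i - 1))) = tail G (r (nat (i + 1)))"
    if "i < 0" "\<not> i + 1 < 0" for i
  proof -
    have "i = - 1" using that by simp
    then show ?thesis using assms(5) by simp
  qed
  ultimately show ?thesis using assms(1,3) unfolding edge_shift_def by auto
qed

text \<open>
  A pair of paths of the same length is kept as one word over pairs of arcs, so that the
  compactness argument applies to both paths at the same time.
\<close>

definition unbridged :: "('v, 'e) pre_digraph \<Rightarrow> ('e \<Rightarrow> 'c) \<Rightarrow> ('e \<times> 'e) list \<Rightarrow> bool" where
  "unbridged G L ps \<longleftrightarrow> map fst ps \<in> paths G \<and> map snd ps \<in> paths G \<and>
     map (L \<circ> fst) ps = map (L \<circ> snd) ps \<and>
     tail G (fst (hd ps)) = tail G (snd (hd ps)) \<and>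
     (\<nexists>v. bridge G L (map fst ps) (map snd ps) v)"

lemma (in wf_digraph) unbridged_prefix:
  assumes "unbridged G L (ps @ qs)" "ps \<noteq> []"
  shows "unbridged G L ps"
proof (cases "qs = []")
  case False
  have "\<nexists>v. bridge G L (map fst ps) (map snd ps) v"
  proof
    assume "\<exists>v. bridge G L (map fst ps) (map snd ps) v"
    then obtain v where "bridge G L (map fst ps) (map snd ps) v" ..
    then have "bridge G L (map fst ps @ map fst qs) (map snd ps @ map snd qs) (v @ map snd qs)"
      by (rule bridge_append) (use assms in \<open>simp_all add: unbridged_def\<close>)
    then show False using assms(1) unfolding unbridged_def map_append by blast
  qed
  then show ?thesis
    using assms False by (simp add: unbridged_def paths_append_iff)
qed (use assms in simp)

lemma (in wf_digraph) ex_unbridged: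
  assumes "\<not> starting_sets_tangled G L D"
  shows "\<exists>ps. unbridged G L ps \<and> length ps = D + 1"
proof -
  obtain u w where uw: "u \<in> paths G" "w \<in> paths G" "length u = D + 1"
    "tail G (hd u) = tail G (hd w)" "map L u = map L w" "\<nexists>v. bridge G L u w v"
    using assms by (auto simp: starting_sets_tangled_iff)
  have len: "length u = length w" using uw(5) by (rule map_eq_imp_length_eq)
  have ne: "zip u w \<noteq> []" "u \<noteq> []" "w \<noteq> []" using len uw(3) by (auto simp flip: length_0_conv)
  then have "hd (zip u w) = (hd u, hd w)" by (cases u; cases w) auto
  then have "unbridged G L (zip u w)"
    using uw len by (auto simp: unbridged_def simp flip: map_map)
  then show ?thesis using uw(3) len by (intro exI[of _ "zip u w"]) simp
qed

lemma (in fin_digraph) starting_sets_tangled_if_right_class_closing: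
  assumes irr: "irreducible_graph G" and C: "right_class_closing G L"
  shows "\<exists>D. starting_sets_tangled G L D"
proof (rule ccontr)
  assume "\<nexists>D. starting_sets_tangled G L D"
  then have long: "\<exists>ps. unbridged G L ps \<and> length ps = D + 1" for D
    using ex_unbridged by blast
  \<comment> \<open>The initial segments of unbridged pairs form a prefix-closed set that contains the empty word;
    the empty pair of paths itself always has a bridge.\<close>
  define T where "T = {ps. \<exists>qs. unbridged G L (ps @ qs)}"
  have arcs: "set ps \<subseteq> arcs G \<times> arcs G" if "unbridged G L ps" for ps
  proof (cases "ps = []")
    case False
    then show ?thesis using that by (force simp: unbridged_def paths_nonempty_iff)
  qed simp
  have "infinite T"
  proof
    assume "finite T"
    then obtain N where N: "\<And>ps. ps \<in> T \<Longrightarrow> length ps < N"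
      using finite_imageI[of T length] finite_nat_set_iff_bounded[of "length ` T"] by auto
    obtain ps where ps: "unbridged G L ps" "length ps = N + 1" using long by blast
    then have "ps \<in> T" unfolding T_def by (auto intro: exI[of _ "[]"])
    then show False using N ps(2) by fastforce
  qed
  moreover have "finite (arcs G \<times> arcs G)" by simp
  moreover have "set ps \<subseteq> arcs G \<times> arcs G" if "ps \<in> T" for ps
    using that arcs unfolding T_def by fastforce
  moreover have "ps \<in> T" if "ps @ qs \<in> T" for ps qs
    using that unfolding T_def by auto
  ultimately obtain f where "\<And>n. map f [0..<n] \<in> T"
    using infinite_tree_has_branch[of "arcs G \<times> arcs G" T] by metis
  then have "\<exists>qs. unbridged G L (map f [0..<Suc n] @ qs)" for n
    unfolding T_def by blast
  then have f: "unbridged G L (map f [0..<Suc n])" for n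
    using unbridged_prefix[of L "map f [0..<Suc n]"] by fastforce
  define r where "r = fst \<circ> f"
  define r' where "r' = snd \<circ> f"
  have up: "map r [0..<Suc n] \<in> paths G" "map r' [0..<Suc n] \<in> paths G"
    "map (L \<circ> r) [0..<Suc n] = map (L \<circ> r') [0..<Suc n]"
    and nb: "\<nexists>v. bridge G L (map r [0..<Suc n]) (map r' [0..<Suc n]) v" for n
    using f[of n] by (simp_all only: unbridged_def r_def r'_def map_map comp_assoc simp_thms)
  have start: "tail G (r 0) = tail G (r' 0)"
    using f[of 0] by (simp add: unbridged_def r_def r'_def)
  have ray: "g k \<in> arcs G \<and> head G (g k) = tail G (g (Suc k))"
    if g: "\<And>n. map g [0..<Suc n] \<in> paths G" for g k
  proof -
    have "set (map g [0..<Suc (Suc k)]) \<subseteq> arcs G"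
      "successively (\<lambda>a b. head G a = tail G b) (map g [0..<Suc (Suc k)])"
      using g[of "Suc k"] by (simp_all add: paths_nonempty_iff del: upt_Suc)
    then show ?thesis
      by (auto simp: successively_append_iff successively_map)
  qed
  have lab: "L (r k) = L (r' k)" for k
    using up(3)[of k] by simp
  obtain h where h: "head G (h 0) = tail G (r 0)"
    "\<And>k. h k \<in> arcs G \<and> head G (h (Suc k)) = tail G (h k)"
    using ex_left_infinite_path[OF irr, of "tail G (r 0)" "r 0"] ray[OF up(1), of 0] by auto
  \<comment> \<open>Prefixing both rays with the same past gives left asymptotic points.\<close>
  define pt :: "(nat \<Rightarrow> 'b) \<Rightarrow> int \<Rightarrow> 'b"
    where "pt g = (\<lambda>i. if i < 0 then h (nat (- i - 1)) else g (nat i))" for g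
  have fib: "same_fibre G L (pt r) (pt r')"
    unfolding same_fibre_def
  proof (intro conjI)
    show "pt r \<in> edge_shift G"
      unfolding pt_def by (rule edge_shift_from_rays) (use h ray[OF up(1)] in auto)
    show "pt r' \<in> edge_shift G"
      unfolding pt_def by (rule edge_shift_from_rays) (use h ray[OF up(2)] start in auto)
    show "block_map L (pt r) = block_map L (pt r')"
      using lab by (auto simp: block_map_def pt_def)
  qed
  have "left_asymptotic (pt r) (pt r')"
    unfolding left_asymptotic_def by (rule exI[of _ "-1"]) (simp add: pt_def)
  then have "right_trans G L (pt r) (pt r')"
    using C fib by (simp add: right_class_closing_def same_fibre_def right_equivalent_def)
  then obtain n v where "bridge G L (window (pt r) 0 (Suc n)) (window (pt r') 0 (Suc n)) v"
    using bridge_if_right_bridge[OF fib] unfolding right_trans_def by blast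
  moreover have "window (pt g) 0 n = map g [0..<n]" for g n
    by (simp add: window_def pt_def)
  ultimately show False using nb by metis
qed

lemma (in fin_digraph) right_class_closing_iff_starting_sets_tangled:
  assumes "irreducible_graph G"
  shows "right_class_closing G L \<longleftrightarrow> (\<exists>D. starting_sets_tangled G L D)"
proof
  assume "\<exists>D. starting_sets_tangled G L D"
  then obtain D where S: "starting_sets_tangled G L D" ..
  show "right_class_closing G L"
    unfolding right_class_closing_def
  proof (intro ballI impI, elim conjE)
    fix x x' assume "x \<in> edge_shift G" "x' \<in> edge_shift G" "block_map L x = block_map L x'"
      and a: "left_asymptotic x x'"
    then have f: "same_fibre G L x x'" "same_fibre G L x' x" by (simp_all add: same_fibre_def)
    have "right_trans G L x x'"
      using S f(1) a by (rule right_trans_if_starting_sets_tangled)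
    moreover have "right_trans G L x' x"
      using S f(2) left_asymptotic_sym[OF a] by (rule right_trans_if_starting_sets_tangled)
    ultimately show "right_equivalent G L x x'"
      using f(1) by (simp add: right_equivalent_def)
  qed
qed (rule starting_sets_tangled_if_right_class_closing[OF assms])

theorem theorem4p4:
  fixes G :: "('v, 'e) pre_digraph" and L :: "'e \<Rightarrow> 'c"
  assumes "fin_digraph G" and "irreducible_graph G"
  defines "X \<equiv> edge_shift G"
  defines "Y \<equiv> block_map L ` X"
  shows
    "(right_class_closing G L \<longleftrightarrow>
        (\<forall>y \<in> Y. \<forall>C \<in> right_classes_over G L y. \<forall>C' \<in> right_classes_over G L y.
           C \<noteq> C' \<longrightarrow> (\<forall>x \<in> C. \<forall>x' \<in> C'. mutually_separated x x'))) \<and>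
     (right_class_closing G L \<longleftrightarrow>
        (\<forall>x \<in> X. left_class G L x \<subseteq> right_class G L x)) \<and>
     (right_class_closing G L \<longleftrightarrow>
        (\<forall>x \<in> X. \<exists>S \<subseteq> left_class G L ` X. right_class G L x = \<Union>S)) \<and>
     (right_class_closing G L \<longleftrightarrow> (\<exists>D. starting_sets_tangled G L D)) \<and>
     (right_class_closing G L \<longleftrightarrow> (\<exists>D. accessible_sets_tangled G L D)) \<and>
     (\<forall>D. starting_sets_tangled G L D \<longleftrightarrow> accessible_sets_tangled G L D)"
proof -
  interpret fin_digraph G by fact
  have tangled: "right_class_closing G L \<longleftrightarrow> (\<exists>D. starting_sets_tangled G L D)"
    using assms(2) by (rule right_class_closing_iff_starting_sets_tangled)
  show ?thesis
    unfolding X_def Y_def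
    using right_class_closing_iff_separated[of G L]
      right_class_closing_iff_left_class_subset[of G L] left_class_subset_iff_union[of G L]
      tangled starting_sets_tangled_iff_accessible[of L]
    by simp
qed

end
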